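(* Let $A\in\mathbb{R}^{n\times n}$ be a symmetric positive semi-definite matrix, and let $m=\sqrt{\|A\|_1\|A\|_\infty}$, so that $\|A\|_2\le m$. Apply the two-sided Jacobi EVD algorithm (described in the context, in exact real arithmetic) to $A$. Then, throughout the run of the algorithm, i.e. at every iteration (every sweep and every index pair $(i,j)$ in it), the variables of the algorithm satisfy the following bounds: \begin{itemize} \item every entry of the working matrix $A$ (the input matrix and all its updates) lies in $[-m,m]$; \item $t\in[-1,1]$; \item $cs\in[0,1]$; \item $sn\in[-1,1]$; \item every entry of $X$ lies in $[-1,1]$; \item $a\in[0,m]$; \item $b\in[0,m]$; \item $c\in[-m,m]$; \item every output value $\lambda_i$, $1\le i\le n$, lies in $[0,m]$. \end{itemize}
   Context: $\|\cdot\|_1$, $\|\cdot\|_\infty$, $\|\cdot\|_2$ are the operator norms (maximum absolute column sum, maximum absolute row sum, spectral norm). Two-sided Jacobi EVD algorithm. Input: a symmetric $n\times n$ real matrix, stored in the working matrix $A$, which is overwritten; $X$ is initialized as the $n\times n$ identity. For each sweep $l=1,\dots,n$, for each $i=1,\dots,n$, for each $j=i+1,\dots,n$, do the following steps in order. (1) Set $a=A(i,i)$, $b=A(j,j)$, $c=A(i,j)=A(j,i)$. (2) Set $t=\dfrac{\mathrm{sign}\left(\frac{b-a}{c}\right)|c|}{\left|\frac{b-a}{2}\right|+\sqrt{c^2+\left(\frac{b-a}{2}\right)^2}}$, $cs=1/\sqrt{1+t^2}$, $sn=cs\cdot t$. Conventions: $\mathrm{sign}(0)=1$, and $t=0$ if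 $c=0$. (3) Set $A(i,i)=a-c\,t$, $A(j,j)=b+c\,t$, $A(i,j)=A(j,i)=0$. (4) For each $k=1,\dots,n$ with $k\ne i,j$: set $tmp=A(i,k)$; then $A(i,k)=cs\cdot tmp-sn\cdot A(j,k)$; then $A(j,k)=sn\cdot tmp+cs\cdot A(j,k)$; then $A(k,i)=A(i,k)$ and $A(k,j)=A(j,k)$. (5) For each $k=1,\dots,n$: set $tmp=X(k,i)$; then $X(k,i)=cs\cdot tmp-sn\cdot X(k,j)$; then $X(k,j)=sn\cdot tmp+cs\cdot X(k,j)$. After all sweeps, output $\lambda_i=A(i,i)$ for $i=1,\dots,n$ (the computed eigenvalues) and $X$ (the computed eigenvectors). In the claim, $m$ is computed once from the input matrix and does not change during the run. *)

theory Defs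
  imports "HOL-Analysis.Analysis"
begin

definition norm_one :: "real^'n^'m \<Rightarrow> real" where
  "norm_one A = (MAX j. \<Sum>i\<in>UNIV. \<bar>A $ i $ j\<bar>)"

definition norm_inf :: "real^'n^'m \<Rightarrow> real" where
  "norm_inf A = (MAX i. \<Sum>j\<in>UNIV. \<bar>A $ i $ j\<bar>)"

definition spectral_norm :: "real^'n^'m \<Rightarrow> real" where
  "spectral_norm A = onorm (\<lambda>x. A *v x)"

definition symmetric_matrix :: "real^'n^'n \<Rightarrow> bool" where
  "symmetric_matrix A \<longleftrightarrow> transpose A = A"

definition pos_semidef :: "real^'n^'n \<Rightarrow> bool" where
  "pos_semidef A \<longleftrightarrow> symmetric_matrix A \<and> (\<forall>x. 0 \<le> x \<bullet> (A *v x))"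

text \<open>Unlike \<^const>\<open>sgn\<close>, this takes the value 1 at 0.\<close>

definition sign1 :: "real \<Rightarrow> real" where
  "sign1 x = (if x \<ge> 0 then 1 else - 1)"

definition set_entry :: "real^'n^'m \<Rightarrow> 'm \<Rightarrow> 'n \<Rightarrow> real \<Rightarrow> real^'n^'m" where
  "set_entry M i j v = (\<chi> r s. if r = i \<and> s = j then v else M $ r $ s)"

text \<open>
  The store of the algorithm. The algorithm is rendered as the list of its elementary
  assignments in execution order, so that a prefix of the list yields an intermediate store.
\<close>

record ('n::finite) jacobi_state =
  mat_A :: "real^'n^'n"
  mat_X :: "real^'n^'n"
  var_a :: real
  var_b :: real
  var_c :: real
  var_t :: real
  var_cs :: real
  var_sn :: real
  var_tmp :: real

type_synonym 'n assignment = "'n jacobi_state \<Rightarrow> 'n jacobi_state"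

definition assign_A :: "'n::finite \<Rightarrow> 'n \<Rightarrow> ('n jacobi_state \<Rightarrow> real) \<Rightarrow> 'n assignment" where
  "assign_A i j e s = s\<lparr>mat_A := set_entry (mat_A s) i j (e s)\<rparr>"

definition assign_X :: "'n::finite \<Rightarrow> 'n \<Rightarrow> ('n jacobi_state \<Rightarrow> real) \<Rightarrow> 'n assignment" where
  "assign_X i j e s = s\<lparr>mat_X := set_entry (mat_X s) i j (e s)\<rparr>"

definition jacobi_t :: "real \<Rightarrow> real \<Rightarrow> real \<Rightarrow> real" where
  "jacobi_t a b c =
     (if c = 0 then 0
      else sign1 ((b - a) / c) * \<bar>c\<bar> / (\<bar>(b - a) / 2\<bar> + sqrt (c\<^sup>2 + ((b - a) / 2)\<^sup>2)))"

text \<open>The index type is linearly ordered; its increasing enumeration plays the role of 1, ..., n.\<close>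

definition indices :: "'n::{finite,linorder} list" where
  "indices = sorted_list_of_set UNIV"

definition rotation_params :: "'n::finite \<Rightarrow> 'n \<Rightarrow> 'n assignment list" where
  "rotation_params i j =
    [\<lambda>s. s\<lparr>var_a := mat_A s $ i $ i\<rparr>,
     \<lambda>s. s\<lparr>var_b := mat_A s $ j $ j\<rparr>,
     \<lambda>s. s\<lparr>var_c := mat_A s $ i $ j\<rparr>,
     \<lambda>s. s\<lparr>var_t := jacobi_t (var_a s) (var_b s) (var_c s)\<rparr>,
     \<lambda>s. s\<lparr>var_cs := 1 / sqrt (1 + (var_t s)\<^sup>2)\<rparr>,
     \<lambda>s. s\<lparr>var_sn := var_cs s * var_t s\<rparr>]"

definition update_pivot :: "'n::finite \<Rightarrow> 'n \<Rightarrow> 'n assignment list" where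
  "update_pivot i j =
    [assign_A i i (\<lambda>s. var_a s - var_c s * var_t s),
     assign_A j j (\<lambda>s. var_b s + var_c s * var_t s),
     assign_A i j (\<lambda>s. 0),
     assign_A j i (\<lambda>s. 0)]"

definition update_A :: "'n::finite \<Rightarrow> 'n \<Rightarrow> 'n \<Rightarrow> 'n assignment list" where
  "update_A i j k =
    [\<lambda>s. s\<lparr>var_tmp := mat_A s $ i $ k\<rparr>,
     assign_A i k (\<lambda>s. var_cs s * var_tmp s - var_sn s * mat_A s $ j $ k),
     assign_A j k (\<lambda>s. var_sn s * var_tmp s + var_cs s * mat_A s $ j $ k),
     assign_A k i (\<lambda>s. mat_A s $ i $ k),
     assign_A k j (\<lambda>s. mat_A s $ j $ k)]"

definition update_X :: "'n::finite \<Rightarrow> 'n \<Rightarrow> 'n \<Rightarrow> 'n assignment list" where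
  "update_X i j k =
    [\<lambda>s. s\<lparr>var_tmp := mat_X s $ k $ i\<rparr>,
     assign_X k i (\<lambda>s. var_cs s * var_tmp s - var_sn s * mat_X s $ k $ j),
     assign_X k j (\<lambda>s. var_sn s * var_tmp s + var_cs s * mat_X s $ k $ j)]"

definition jacobi_iteration :: "'n::{finite,linorder} \<Rightarrow> 'n \<Rightarrow> 'n assignment list" where
  "jacobi_iteration i j =
     rotation_params i j @ update_pivot i j @
     concat (map (update_A i j) (filter (\<lambda>k. k \<noteq> i \<and> k \<noteq> j) indices)) @
     concat (map (update_X i j) indices)"

definition jacobi_sweep :: "'n::{finite,linorder} assignment list" where
  "jacobi_sweep =
     concat (map (\<lambda>i. concat (map (jacobi_iteration i) (filter (\<lambda>j. i < j) indices))) indices)"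

definition jacobi_program :: "'n::{finite,linorder} assignment list" where
  "jacobi_program = concat (replicate CARD('n) jacobi_sweep)"

text \<open>
  The scalar variables are always assigned before they are read, so their initial value 0 has
  no influence on the run. It lies in every interval claimed for them, so a bound on a scalar
  at all points of the run says the same as the bound at all points after its first assignment.
\<close>

definition jacobi_init :: "real^'n^'n \<Rightarrow> 'n jacobi_state" where
  "jacobi_init A =
     \<lparr>mat_A = A, mat_X = mat 1, var_a = 0, var_b = 0, var_c = 0,
      var_t = 0, var_cs = 0, var_sn = 0, var_tmp = 0\<rparr>"

definition execute :: "'n::finite assignment list \<Rightarrow> 'n jacobi_state \<Rightarrow> 'n jacobi_state" where
  "execute P s = fold (\<lambda>f. f) P s"

definition jacobi_run :: "real^'n::{finite,linorder}^'n::{finite,linorder} \<Rightarrow> 'n jacobi_state set" where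
  "jacobi_run A =
     {execute (take p jacobi_program) (jacobi_init A) | p. p \<le> length (jacobi_program :: 'n assignment list)}"

definition jacobi_lambda :: "real^'n::{finite,linorder}^'n::{finite,linorder} \<Rightarrow> 'n \<Rightarrow> real" where
  "jacobi_lambda A i = mat_A (execute jacobi_program (jacobi_init A)) $ i $ i"

end

theory Submission
  imports Defs
begin

text \<open>
  One iteration replaces \<open>A\<close> by \<open>J A J\<^sup>T\<close> and \<open>X\<close> by \<open>X J\<^sup>T\<close> for a plane rotation \<open>J\<close>. Hence, between
  iterations, \<open>A\<close> stays symmetric with \<open>0 \<le> x \<bullet> A x \<le> m |x|\<^sup>2\<close>, because orthogonal conjugation
  only changes the vector \<open>x\<close> into another one of the same length, and \<open>X\<close> stays orthogonal.
  This invariant yields all bounds on matrix entries: diagonal entries of \<open>A\<close> are values of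
  the quadratic form at unit vectors, so they lie in \<open>[0, m]\<close>; positivity at \<open>e\<^sub>i \<plusminus> e\<^sub>j\<close> bounds an
  off-diagonal entry by the mean of two diagonal ones; and the rows of \<open>X\<close> are unit vectors.
  It holds initially since \<open>|A x| \<le> m |x|\<close>, which is Schur's test
  (\<open>norm_matrix_vector_le\<close>) and also the bound on the spectral norm.

  Two points need care. The algorithm does not compute the pivot block of \<open>J A J\<^sup>T\<close> but assigns
  \<open>a - c t\<close>, \<open>b + c t\<close> and \<open>0\<close>; these are the right values because \<open>t\<close> solves
  \<open>c t\<^sup>2 + (b - a) t = c\<close> (\<open>jacobi_t_quadratic\<close>). And inside an iteration \<open>A\<close> is neither the old
  nor the new matrix, so the invariant may fail there. But each pass of an update loop computes
  the new entries from old ones that no earlier pass has touched. So at every instant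
  each entry of \<open>A\<close> or \<open>X\<close> equals that entry of the old or of the new matrix, and both satisfy the
  bounds. The locale \<open>jacobi_step\<close> records which entries are already new.
\<close>

section \<open>Assertions along a straight-line program\<close>

text \<open>
  The weakest precondition of a program for the postcondition \<open>R\<close>, under the additional demand
  that \<open>Q\<close> holds in every state passed through, both ends included. The postcondition lets
  invariants be chained from one piece of the program to the next; \<open>Q\<close> is for bounds that
  have to hold between the pieces as well as in the middle of each.
\<close>

primrec runs_within :: "('s \<Rightarrow> bool) \<Rightarrow> ('s \<Rightarrow> 's) list \<Rightarrow> ('s \<Rightarrow> bool) \<Rightarrow> 's \<Rightarrow> bool" where
  "runs_within Q [] R s \<longleftrightarrow> Q s \<and> R s"
| "runs_within Q (f # P) R s \<longleftrightarrow> Q s \<and> runs_within Q P R (f s)"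

lemma runs_within_start: "runs_within Q P R s \<Longrightarrow> Q s"
  by (cases P) auto

lemma runs_within_append:
  "runs_within Q (P @ P') R s \<longleftrightarrow> runs_within Q P (runs_within Q P' R) s"
  by (induction P arbitrary: s) (auto dest: runs_within_start)

lemma runs_within_mono:
  assumes "runs_within Q P R s" and "\<And>s. Q s \<Longrightarrow> R s \<Longrightarrow> R' s"
  shows "runs_within Q P R' s"
  using assms(1) by (induction P arbitrary: s) (auto intro: assms(2))

lemma runs_within_concat:
  assumes "\<And>P s. P \<in> set Ps \<Longrightarrow> R s \<Longrightarrow> runs_within Q P R s"
    and "R s" and "Q s"
  shows "runs_within Q (concat Ps) R s"
  using assms
proof (induction Ps arbitrary: s)
  case Nil
  then show ?case by simp
next
  case (Cons P Ps)
  have "runs_within Q P R s"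
    using Cons.prems by simp
  then have "runs_within Q P (runs_within Q (concat Ps) R) s"
    by (rule runs_within_mono) (use Cons in auto)
  then show ?case
    by (simp add: runs_within_append)
qed

text \<open>
  Loop rule for an invariant \<open>I D\<close> that depends on the set \<open>D\<close> of indices already processed. A body
  may assume that its own index is new, which is what guarantees that it reads entries
  that no earlier pass of the loop has changed.
\<close>

lemma runs_within_loop:
  assumes "\<And>k D s. k \<in> set ks \<Longrightarrow> k \<notin> D \<Longrightarrow> I D s \<Longrightarrow>
      runs_within Q (body k) (I (insert k D)) s"
    and "distinct ks" and "set ks \<inter> D = {}" and "I D s" and "Q s"
  shows "runs_within Q (concat (map body ks)) (I (D \<union> set ks)) s"
  using assms
proof (induction ks arbitrary: s D)
  case Nil
  then show ?case by simp
next
  case (Cons k ks)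
  have "runs_within Q (body k) (I (insert k D)) s"
    using Cons.prems by simp
  then have "runs_within Q (body k)
      (runs_within Q (concat (map body ks)) (I (insert k D \<union> set ks))) s"
    by (rule runs_within_mono) (rule Cons.IH, use Cons.prems in auto)
  then show ?case
    by (simp add: runs_within_append)
qed

lemma runs_within_execute:
  assumes "runs_within Q P R s"
  shows "Q (execute (take p P) s)" and "R (execute P s)"
proof -
  have "(\<forall>p. Q (execute (take p P) s)) \<and> R (execute P s)"
    using assms
  proof (induction P arbitrary: s)
    case Nil
    then show ?case by (simp add: execute_def)
  next
    case (Cons f P)
    have "Q (execute (take p (f # P)) s)" for p
      using Cons by (cases p) (auto simp: execute_def)
    with Cons show ?case by (simp add: execute_def)
  qed
  then show "Q (execute (take p P) s)" and "R (execute P s)" by auto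
qed

section \<open>The parameters of a Jacobi rotation\<close>

lemma abs_jacobi_t_le_1: "\<bar>jacobi_t a b c\<bar> \<le> 1"
proof (cases "c = 0")
  case True
  then show ?thesis by (simp add: jacobi_t_def)
next
  case False
  have "\<bar>c\<bar> \<le> sqrt (c\<^sup>2 + ((b - a) / 2)\<^sup>2)"
    by (rule real_le_rsqrt) simp
  then have "\<bar>c\<bar> \<le> \<bar>(b - a) / 2\<bar> + sqrt (c\<^sup>2 + ((b - a) / 2)\<^sup>2)"
    using abs_ge_zero[of "(b - a) / 2"] by linarith
  moreover have "\<bar>sign1 ((b - a) / c)\<bar> = 1"
    by (simp add: sign1_def)
  ultimately show ?thesis
    using False by (simp add: jacobi_t_def abs_mult)
qed

text \<open>
  The equation says that the rotation with tangent \<open>t\<close> annihilates the pivot entry. For \<open>c \<noteq> 0\<close>, with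
  \<open>d = (b - a) / 2\<close> and \<open>S = sqrt (c\<^sup>2 + d\<^sup>2)\<close>, it is the quadratic \<open>c t\<^sup>2 + 2 d t - c = 0\<close>, of which \<open>t\<close> is
  the root of smaller modulus, written without cancellation. For \<open>d = 0\<close> both roots \<open>1\<close> and \<open>-1\<close>
  have the same modulus, and the convention that 0 has sign 1 selects \<open>1\<close>.
\<close>

lemma jacobi_t_quadratic:
  fixes a b c :: real
  defines "t \<equiv> jacobi_t a b c"
  shows "c * t\<^sup>2 + (b - a) * t = c"
proof (cases "c = 0")
  case True
  then show ?thesis by (simp add: t_def jacobi_t_def)
next
  case False
  define d where "d = (b - a) / 2"
  define S where "S = sqrt (c\<^sup>2 + d\<^sup>2)"
  define D where "D = \<bar>d\<bar> + S"
  have S2: "S\<^sup>2 = c\<^sup>2 + d\<^sup>2" by (simp add: S_def)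
  have "S > 0" using False by (simp add: S_def add_pos_nonneg)
  then have "D > 0" by (simp add: D_def add_nonneg_pos)
  define u where "u = sign1 ((b - a) / c) * \<bar>c\<bar>"
  have t: "t = u / D"
    using False by (simp add: t_def jacobi_t_def u_def D_def S_def d_def)
  have u2: "u\<^sup>2 = c\<^sup>2"
    by (simp add: u_def sign1_def power_mult_distrib)
  have du: "d * u = \<bar>d\<bar> * c"
    using False by (auto simp: u_def d_def sign1_def zero_le_divide_iff abs_if)
  have "c * u\<^sup>2 + 2 * (d * u) * D = c * D\<^sup>2"
    unfolding u2 du D_def using S2 by (simp add: power2_eq_square algebra_simps)
  then have "c * t\<^sup>2 + 2 * d * t = c"
    using \<open>D > 0\<close> by (simp add: t power_divide field_simps power2_eq_square)
  moreover have "2 * d = b - a" by (simp add: d_def)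
  ultimately show ?thesis by simp
qed

lemma rotation_cosine:
  "0 \<le> 1 / sqrt (1 + t\<^sup>2)" "1 / sqrt (1 + t\<^sup>2) \<le> 1" "(1 / sqrt (1 + t\<^sup>2))\<^sup>2 * (1 + t\<^sup>2) = 1"
    for t :: real
proof -
  have "1 + t\<^sup>2 > 0" by (simp add: add_pos_nonneg)
  then show "0 \<le> 1 / sqrt (1 + t\<^sup>2)" "1 / sqrt (1 + t\<^sup>2) \<le> 1"
      "(1 / sqrt (1 + t\<^sup>2))\<^sup>2 * (1 + t\<^sup>2) = 1"
    by (auto simp: power_divide)
qed

section \<open>Plane rotations\<close>

definition givens :: "'n::finite \<Rightarrow> 'n \<Rightarrow> real \<Rightarrow> real \<Rightarrow> real^'n^'n" where
  "givens i j c s =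
     (\<chi> r. if r = i then c *\<^sub>R axis i 1 - s *\<^sub>R axis j 1
           else if r = j then s *\<^sub>R axis i 1 + c *\<^sub>R axis j 1
           else axis r 1)"

lemma givens_mult_entry:
  "(givens i j c s ** M) $ r $ l =
     (if r = i then c * M $ i $ l - s * M $ j $ l
      else if r = j then s * M $ i $ l + c * M $ j $ l
      else M $ r $ l)"
proof -
  have row: "(\<Sum>k\<in>UNIV. axis p (1::real) $ k * M $ k $ l) = M $ p $ l" for p
    by (simp add: axis_def if_distrib[of "\<lambda>x. x * _"] cong: if_cong)
  show ?thesis
    by (simp add: givens_def matrix_matrix_mult_def ring_distribs sum.distrib sum_subtractf
        mult.assoc row flip: sum_distrib_left)
qed

lemma mult_transpose_givens_entry:
  "(M ** transpose (givens i j c s)) $ l $ r =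
     (if r = i then c * M $ l $ i - s * M $ l $ j
      else if r = j then s * M $ l $ i + c * M $ l $ j
      else M $ l $ r)"
proof -
  have "M ** transpose (givens i j c s) = transpose (givens i j c s ** transpose M)"
    by (simp add: matrix_transpose_mul)
  then show ?thesis
    by (simp add: transpose_def[of "_ ** _"] givens_mult_entry) (simp add: transpose_def)
qed

text \<open>
  Multiplying by the transposed rotation on the right is known entrywise, so it suffices to
  apply this to the rotation itself.
\<close>

lemma orthogonal_matrix_givens:
  assumes "i \<noteq> j" and "c\<^sup>2 + s\<^sup>2 = 1"
  shows "orthogonal_matrix (givens i j c s)"
proof -
  have "givens i j c s ** transpose (givens i j c s) = mat 1"
    using assms
    by (auto simp: vec_eq_iff mult_transpose_givens_entry)
       (auto simp: givens_def axis_def mat_def power2_eq_square algebra_simps)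
  then have "orthogonal_matrix (transpose (givens i j c s))"
    by (simp add: orthogonal_matrix)
  then show ?thesis by simp
qed

lemma orthogonal_matrix_entry_bound:
  fixes X :: "real^'n^'n"
  assumes "orthogonal_matrix X"
  shows "X $ r $ l \<in> {-1..1}"
proof -
  have "norm (row r X) = 1"
    using assms by (simp add: orthogonal_matrix_orthonormal_rows)
  then have "\<bar>X $ r $ l\<bar> \<le> 1"
    using component_le_norm_cart[of "row r X" l] by (simp add: row_def)
  then show ?thesis by auto
qed

section \<open>Symmetric matrices with spectrum in an interval\<close>

text \<open>
  The condition on the eigenvalues is put in terms of the quadratic form, for which invariance
  under orthogonal conjugation is a substitution.
\<close>

definition spectrum_within :: "real \<Rightarrow> real^'n^'n \<Rightarrow> bool" where
  "spectrum_within m M \<longleftrightarrow>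
     symmetric_matrix M \<and> (\<forall>x. 0 \<le> x \<bullet> (M *v x) \<and> x \<bullet> (M *v x) \<le> m * (x \<bullet> x))"

lemma symmetric_matrix_entry: "symmetric_matrix M \<Longrightarrow> M $ r $ l = M $ l $ r"
  by (simp add: symmetric_matrix_def transpose_def vec_eq_iff)

lemma axis_quadratic_form:
  fixes M :: "real^'n^'n"
  shows "axis i 1 \<bullet> (M *v axis j 1) = M $ i $ j"
  by (simp add: inner_axis' matrix_vector_mult_basis column_def)

lemma spectrum_within_diag:
  fixes M :: "real^'n^'n"
  assumes "spectrum_within m M"
  shows "M $ i $ i \<in> {0..m}"
proof -
  have "0 \<le> axis i 1 \<bullet> (M *v axis i 1)" "axis i 1 \<bullet> (M *v axis i 1) \<le> m * (axis i 1 \<bullet> axis i (1::real))"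
    using assms unfolding spectrum_within_def by blast+
  then show ?thesis by (simp only: axis_quadratic_form) (simp add: inner_axis_axis)
qed

text \<open>
  Positivity at \<open>e\<^sub>i + e\<^sub>j\<close> and at \<open>e\<^sub>i - e\<^sub>j\<close> gives \<open>2 |M\<^sub>i\<^sub>j| \<le> M\<^sub>i\<^sub>i + M\<^sub>j\<^sub>j\<close>, and diagonal entries are at most \<open>m\<close>.
\<close>

lemma spectrum_within_entry:
  fixes M :: "real^'n^'n"
  assumes "spectrum_within m M"
  shows "M $ i $ j \<in> {-m..m}"
proof -
  let ?e = "axis i (1::real)" and ?f = "axis j (1::real)"
  have "0 \<le> (?e + ?f) \<bullet> (M *v (?e + ?f))" "0 \<le> (?e - ?f) \<bullet> (M *v (?e - ?f))"
    using assms unfolding spectrum_within_def by blast+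
  then have "0 \<le> M $ i $ i + M $ i $ j + M $ j $ i + M $ j $ j"
      "0 \<le> M $ i $ i - M $ i $ j - M $ j $ i + M $ j $ j"
    by (auto simp: algebra_simps axis_quadratic_form)
  moreover have "M $ j $ i = M $ i $ j"
    using assms symmetric_matrix_entry unfolding spectrum_within_def by blast
  ultimately show ?thesis
    using spectrum_within_diag[OF assms, of i] spectrum_within_diag[OF assms, of j] by auto
qed

lemma spectrum_within_conjugate:
  fixes M J :: "real^'n^'n"
  assumes M: "spectrum_within m M" and J: "orthogonal_matrix J"
  shows "spectrum_within m (J ** M ** transpose J)"
proof -
  have "symmetric_matrix (J ** M ** transpose J)"
    using M by (simp add: spectrum_within_def symmetric_matrix_def matrix_transpose_mul
        matrix_mul_assoc)
  moreover have "x \<bullet> ((J ** M ** transpose J) *v x) = (transpose J *v x) \<bullet> (M *v (transpose J *v x))" for x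
    by (simp add: dot_lmul_matrix flip: matrix_vector_mul_assoc)
  moreover have "(transpose J *v x) \<bullet> (transpose J *v x) = x \<bullet> x" for x
  proof -
    have "(transpose J *v x) \<bullet> (transpose J *v x) = x \<bullet> ((J ** transpose J) *v x)"
      by (simp add: dot_lmul_matrix flip: matrix_vector_mul_assoc)
    then show ?thesis using J by (simp add: orthogonal_matrix_def)
  qed
  ultimately show ?thesis
    using M by (metis spectrum_within_def)
qed

text \<open>
  Schur's test. Splitting each entry as \<open>sqrt |A\<^sub>i\<^sub>j| * (\<plusminus> sqrt |A\<^sub>i\<^sub>j|)\<close> and applying the Cauchy-Schwarz
  inequality to each row costs one factor \<open>norm_inf A\<close>; exchanging the two summations then turns
  the remaining row sums into column sums, which cost the factor \<open>norm_one A\<close>.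
\<close>

lemma norm_matrix_vector_le:
  fixes A :: "real^'n^'m"
  shows "norm (A *v x) \<le> sqrt (norm_one A * norm_inf A) * norm x"
proof -
  have col: "(\<Sum>i\<in>UNIV. \<bar>A $ i $ j\<bar>) \<le> norm_one A" for j
    unfolding norm_one_def by (rule Max_ge) auto
  have row: "(\<Sum>j\<in>UNIV. \<bar>A $ i $ j\<bar>) \<le> norm_inf A" for i
    unfolding norm_inf_def by (rule Max_ge) auto
  have inf0: "0 \<le> norm_inf A"
    using row[of undefined] by (rule order_trans[rotated]) (simp add: sum_nonneg)
  have comp: "((A *v x) $ i)\<^sup>2 \<le> norm_inf A * (\<Sum>j\<in>UNIV. \<bar>A $ i $ j\<bar> * (x $ j)\<^sup>2)" for i
  proof -
    have entry: "A $ i $ j * x $ j = sqrt \<bar>A $ i $ j\<bar> * (sgn (A $ i $ j) * sqrt \<bar>A $ i $ j\<bar> * x $ j)" for j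
    proof -
      have "sqrt \<bar>A $ i $ j\<bar> * (sgn (A $ i $ j) * sqrt \<bar>A $ i $ j\<bar> * x $ j)
          = (sqrt \<bar>A $ i $ j\<bar> * sqrt \<bar>A $ i $ j\<bar>) * sgn (A $ i $ j) * x $ j"
        by (simp only: mult_ac)
      also have "\<dots> = A $ i $ j * x $ j" by (simp add: abs_mult_sgn)
      finally show ?thesis ..
    qed
    have "((A *v x) $ i)\<^sup>2 =
        (\<Sum>j\<in>UNIV. sqrt \<bar>A $ i $ j\<bar> * (sgn (A $ i $ j) * sqrt \<bar>A $ i $ j\<bar> * x $ j))\<^sup>2"
      by (simp only: matrix_vector_mult_def vec_lambda_beta entry)
    also have "\<dots> \<le> (\<Sum>j\<in>UNIV. (sqrt \<bar>A $ i $ j\<bar>)\<^sup>2) *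
        (\<Sum>j\<in>UNIV. (sgn (A $ i $ j) * sqrt \<bar>A $ i $ j\<bar> * x $ j)\<^sup>2)"
      by (rule Cauchy_Schwarz_ineq_sum)
    also have "\<dots> = (\<Sum>j\<in>UNIV. \<bar>A $ i $ j\<bar>) * (\<Sum>j\<in>UNIV. \<bar>A $ i $ j\<bar> * (x $ j)\<^sup>2)"
    proof -
      have "(sgn (A $ i $ j) * sqrt \<bar>A $ i $ j\<bar> * x $ j)\<^sup>2 = \<bar>A $ i $ j\<bar> * (x $ j)\<^sup>2" for j
        by (simp add: power_mult_distrib sgn_if)
      then show ?thesis by simp
    qed
    also have "\<dots> \<le> norm_inf A * (\<Sum>j\<in>UNIV. \<bar>A $ i $ j\<bar> * (x $ j)\<^sup>2)"
      by (rule mult_right_mono[OF row]) (simp add: sum_nonneg)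
    finally show ?thesis .
  qed
  have "(norm (A *v x))\<^sup>2 = (\<Sum>i\<in>UNIV. ((A *v x) $ i)\<^sup>2)"
    by (simp add: norm_vec_def L2_set_def sum_nonneg)
  also have "\<dots> \<le> (\<Sum>i\<in>UNIV. norm_inf A * (\<Sum>j\<in>UNIV. \<bar>A $ i $ j\<bar> * (x $ j)\<^sup>2))"
    by (rule sum_mono) (rule comp)
  also have "\<dots> = norm_inf A * (\<Sum>j\<in>UNIV. (\<Sum>i\<in>UNIV. \<bar>A $ i $ j\<bar>) * (x $ j)\<^sup>2)"
    by (subst sum_distrib_left[symmetric], subst sum.swap) (simp add: sum_distrib_right)
  also have "\<dots> \<le> norm_inf A * (\<Sum>j\<in>UNIV. norm_one A * (x $ j)\<^sup>2)"
    by (intro mult_left_mono sum_mono mult_right_mono col inf0) simp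
  also have "\<dots> = norm_one A * norm_inf A * (norm x)\<^sup>2"
    by (simp add: norm_vec_def L2_set_def sum_nonneg sum_distrib_left mult_ac)
  finally have "norm (A *v x) \<le> sqrt (norm_one A * norm_inf A * (norm x)\<^sup>2)"
    by (rule real_le_rsqrt)
  then show ?thesis by (simp add: real_sqrt_mult)
qed

lemma spectral_norm_le: "spectral_norm A \<le> sqrt (norm_one A * norm_inf A)"
  unfolding spectral_norm_def by (rule onorm_le) (rule norm_matrix_vector_le)

lemma spectrum_within_pos_semidef:
  fixes A :: "real^'n^'n"
  assumes "pos_semidef A"
  shows "spectrum_within (sqrt (norm_one A * norm_inf A)) A"
proof -
  have "x \<bullet> (A *v x) \<le> sqrt (norm_one A * norm_inf A) * (x \<bullet> x)" for x
  proof -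
    have "x \<bullet> (A *v x) \<le> norm x * norm (A *v x)"
      by (rule norm_cauchy_schwarz)
    also have "\<dots> \<le> norm x * (sqrt (norm_one A * norm_inf A) * norm x)"
      by (rule mult_left_mono[OF norm_matrix_vector_le]) simp
    finally show ?thesis by (simp add: dot_square_norm power2_eq_square mult_ac)
  qed
  with assms show ?thesis by (simp add: pos_semidef_def spectrum_within_def)
qed

section \<open>One iteration of the algorithm\<close>

definition within_bounds :: "real \<Rightarrow> 'n::finite jacobi_state \<Rightarrow> bool" where
  "within_bounds m s \<longleftrightarrow>
     (\<forall>i j. mat_A s $ i $ j \<in> {-m..m}) \<and>
     var_t s \<in> {-1..1} \<and>
     var_cs s \<in> {0..1} \<and>
     var_sn s \<in> {-1..1} \<and>
     (\<forall>i j. mat_X s $ i $ j \<in> {-1..1}) \<and>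
     var_a s \<in> {0..m} \<and>
     var_b s \<in> {0..m} \<and>
     var_c s \<in> {-m..m}"

text \<open>
  Meant for the points between iterations: the partially updated matrices within an iteration
  need not be symmetric or orthogonal. The bounds in it are what survives at those points.
\<close>

definition jacobi_invariant :: "real \<Rightarrow> 'n::finite jacobi_state \<Rightarrow> bool" where
  "jacobi_invariant m s \<longleftrightarrow>
     within_bounds m s \<and> spectrum_within m (mat_A s) \<and> orthogonal_matrix (mat_X s)"

lemma entry_set_entry: "set_entry M i j v $ r $ l = (if r = i \<and> l = j then v else M $ r $ l)"
  by (simp add: set_entry_def)

lemma select_assign [simp]:
  "mat_A (assign_A i j e s) = set_entry (mat_A s) i j (e s)"
  "mat_X (assign_A i j e s) = mat_X s"
  "var_a (assign_A i j e s) = var_a s" "var_b (assign_A i j e s) = var_b s"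
  "var_c (assign_A i j e s) = var_c s" "var_t (assign_A i j e s) = var_t s"
  "var_cs (assign_A i j e s) = var_cs s" "var_sn (assign_A i j e s) = var_sn s"
  "var_tmp (assign_A i j e s) = var_tmp s"
  "mat_A (assign_X i j e s) = mat_A s"
  "mat_X (assign_X i j e s) = set_entry (mat_X s) i j (e s)"
  "var_cs (assign_X i j e s) = var_cs s" "var_sn (assign_X i j e s) = var_sn s"
  "var_tmp (assign_X i j e s) = var_tmp s"
  by (simp_all add: assign_A_def assign_X_def)

lemma within_bounds_assign_A:
  "within_bounds m s \<Longrightarrow> e s \<in> {-m..m} \<Longrightarrow> within_bounds m (assign_A i j e s)"
  by (simp add: within_bounds_def assign_A_def entry_set_entry)

lemma within_bounds_assign_X:
  "within_bounds m s \<Longrightarrow> e s \<in> {-1..1} \<Longrightarrow> within_bounds m (assign_X i j e s)"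
  by (simp add: within_bounds_def assign_X_def entry_set_entry)

lemma within_bounds_scalars:
  "within_bounds m s \<Longrightarrow> v \<in> {0..m} \<Longrightarrow> within_bounds m (s\<lparr>var_a := v\<rparr>)"
  "within_bounds m s \<Longrightarrow> v \<in> {0..m} \<Longrightarrow> within_bounds m (s\<lparr>var_b := v\<rparr>)"
  "within_bounds m s \<Longrightarrow> v \<in> {-m..m} \<Longrightarrow> within_bounds m (s\<lparr>var_c := v\<rparr>)"
  "within_bounds m s \<Longrightarrow> v \<in> {-1..1} \<Longrightarrow> within_bounds m (s\<lparr>var_t := v\<rparr>)"
  "within_bounds m s \<Longrightarrow> v \<in> {0..1} \<Longrightarrow> within_bounds m (s\<lparr>var_cs := v\<rparr>)"
  "within_bounds m s \<Longrightarrow> v \<in> {-1..1} \<Longrightarrow> within_bounds m (s\<lparr>var_sn := v\<rparr>)"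
  by (simp_all add: within_bounds_def)

lemma within_bounds_tmp: "within_bounds m (s\<lparr>var_tmp := v\<rparr>) \<longleftrightarrow> within_bounds m s"
  by (simp add: within_bounds_def)

text \<open>
  A single iteration with pivot \<open>(i, j)\<close>, started with \<open>A = M\<close> and \<open>X\<close>, and meant to end with
  \<open>A = M'\<close> and \<open>X'\<close>.
\<close>

locale jacobi_step =
  fixes m :: real and i j :: "'n::{finite,linorder}" and M X :: "real^'n::{finite,linorder}^'n::{finite,linorder}"
  assumes pivot: "i \<noteq> j" and spectrum: "spectrum_within m M" and orth: "orthogonal_matrix X"
begin

definition "t = jacobi_t (M $ i $ i) (M $ j $ j) (M $ i $ j)"
definition "cs = 1 / sqrt (1 + t\<^sup>2)"
definition "sn = cs * t"
definition "J = givens i j cs sn"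
definition "M' = J ** M ** transpose J"
definition "X' = X ** transpose J"

text \<open>
  The matrices in the middle of an iteration. Only the rows and columns \<open>i\<close> and \<open>j\<close> of \<open>A\<close> change,
  and those of their entries that cross an index in \<open>D\<close> are already new. The pivot block itself
  is new as soon as \<open>D\<close> contains \<open>i\<close> and \<open>j\<close>. For \<open>X\<close>, which is rotated on one side only, whole
  rows become new.
\<close>

definition mixed_A :: "'n set \<Rightarrow> real^'n::{finite,linorder}^'n::{finite,linorder}" where
  "mixed_A D =
     (\<chi> r l. if r \<in> {i, j} \<and> l \<in> D \<or> l \<in> {i, j} \<and> r \<in> D then M' $ r $ l else M $ r $ l)"

definition mixed_X :: "'n set \<Rightarrow> real^'n::{finite,linorder}^'n::{finite,linorder}" where
  "mixed_X D = (\<chi> r. if r \<in> D then X' $ r else X $ r)"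

lemma cs_sn: "cs\<^sup>2 + sn\<^sup>2 = 1"
proof -
  have "cs\<^sup>2 + sn\<^sup>2 = cs\<^sup>2 * (1 + t\<^sup>2)" by (simp add: sn_def power_mult_distrib algebra_simps)
  then show ?thesis by (simp add: cs_def rotation_cosine(3))
qed

lemma orthogonal_J: "orthogonal_matrix J"
  unfolding J_def by (rule orthogonal_matrix_givens[OF pivot cs_sn])

lemma spectrum': "spectrum_within m M'"
  unfolding M'_def by (rule spectrum_within_conjugate[OF spectrum orthogonal_J])

lemma orth': "orthogonal_matrix X'"
  unfolding X'_def by (rule orthogonal_matrix_mul) (simp_all add: orth orthogonal_J)

lemma sym: "M $ r $ l = M $ l $ r"
  using spectrum symmetric_matrix_entry by (auto simp: spectrum_within_def)

lemma sym': "M' $ r $ l = M' $ l $ r"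
  using spectrum' symmetric_matrix_entry by (auto simp: spectrum_within_def)

lemma M'_row:
  assumes "k \<notin> {i, j}"
  shows "M' $ i $ k = cs * M $ i $ k - sn * M $ j $ k"
    and "M' $ j $ k = sn * M $ i $ k + cs * M $ j $ k"
  using assms pivot by (auto simp: M'_def J_def mult_transpose_givens_entry givens_mult_entry)

lemma M'_off: "r \<notin> {i, j} \<Longrightarrow> l \<notin> {i, j} \<Longrightarrow> M' $ r $ l = M $ r $ l"
  by (simp add: M'_def J_def mult_transpose_givens_entry givens_mult_entry)

text \<open>
  Each entry of the rotated pivot block is \<open>cs\<^sup>2\<close> times a polynomial in \<open>a\<close>, \<open>b\<close>, \<open>c\<close>, \<open>t\<close>. Up to a multiple
  of the quadratic equation for \<open>t\<close>, this polynomial is \<open>1 + t\<^sup>2\<close> times the assigned value.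
\<close>

lemma M'_pivot:
  defines "a \<equiv> M $ i $ i" and "b \<equiv> M $ j $ j" and "c \<equiv> M $ i $ j"
  shows "M' $ i $ i = a - c * t" and "M' $ j $ j = b + c * t"
    and "M' $ i $ j = 0" and "M' $ j $ i = 0"
proof -
  have q: "c * t\<^sup>2 + (b - a) * t = c"
    unfolding t_def a_def b_def c_def by (rule jacobi_t_quadratic)
  have cs2: "cs\<^sup>2 * (1 + t\<^sup>2) = 1"
    by (simp add: cs_def rotation_cosine(3))
  have ji: "M $ j $ i = c" by (simp add: c_def sym)
  have "M' $ i $ i = cs\<^sup>2 * (a - 2 * c * t + b * t\<^sup>2)"
    using pivot ji by (simp add: M'_def J_def mult_transpose_givens_entry givens_mult_entry
        flip: a_def b_def c_def) (simp add: sn_def power2_eq_square algebra_simps)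
  also have "a - 2 * c * t + b * t\<^sup>2 = (1 + t\<^sup>2) * (a - c * t)
      - t * (c - (c * t\<^sup>2 + (b - a) * t))"
    by (simp add: power2_eq_square algebra_simps)
  finally show "M' $ i $ i = a - c * t"
    using cs2 by (simp add: q flip: mult.assoc)
  have "M' $ j $ j = cs\<^sup>2 * (b + 2 * c * t + a * t\<^sup>2)"
    using pivot ji by (simp add: M'_def J_def mult_transpose_givens_entry givens_mult_entry
        flip: a_def b_def c_def) (simp add: sn_def power2_eq_square algebra_simps)
  also have "b + 2 * c * t + a * t\<^sup>2 = (1 + t\<^sup>2) * (b + c * t)
      + t * (c - (c * t\<^sup>2 + (b - a) * t))"
    by (simp add: power2_eq_square algebra_simps)
  finally show "M' $ j $ j = b + c * t"
    using cs2 by (simp add: q flip: mult.assoc)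
  have "M' $ i $ j = cs\<^sup>2 * (c - (c * t\<^sup>2 + (b - a) * t))"
    using pivot ji by (simp add: M'_def J_def mult_transpose_givens_entry givens_mult_entry
        flip: a_def b_def c_def) (simp add: sn_def power2_eq_square algebra_simps)
  then show "M' $ i $ j = 0" using q by simp
  then show "M' $ j $ i = 0" by (simp add: sym')
qed

lemma X'_row:
  "X' $ k $ i = cs * X $ k $ i - sn * X $ k $ j"
  "X' $ k $ j = sn * X $ k $ i + cs * X $ k $ j"
  "l \<notin> {i, j} \<Longrightarrow> X' $ k $ l = X $ k $ l"
  using pivot by (auto simp: X'_def J_def mult_transpose_givens_entry)

text \<open>
  The invariant of both update loops. The pivot indices belong to \<open>D\<close> from the start, because the
  pivot block is assigned before the loops; \<open>E\<close> is empty until the loop over \<open>X\<close> begins.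
\<close>

definition rotating :: "'n set \<Rightarrow> 'n set \<Rightarrow> 'n jacobi_state \<Rightarrow> bool" where
  "rotating D E s \<longleftrightarrow> within_bounds m s \<and> mat_A s = mixed_A D \<and> mat_X s = mixed_X E \<and>
     var_cs s = cs \<and> var_sn s = sn"

definition params_set :: "'n jacobi_state \<Rightarrow> bool" where
  "params_set s \<longleftrightarrow> within_bounds m s \<and> mat_A s = M \<and> mat_X s = X \<and>
     var_a s = M $ i $ i \<and> var_b s = M $ j $ j \<and> var_c s = M $ i $ j \<and>
     var_t s = t \<and> var_cs s = cs \<and> var_sn s = sn"

lemma runs_within_rotation_params:
  assumes "within_bounds m s" and "mat_A s = M" and "mat_X s = X"
  shows "runs_within (within_bounds m) (rotation_params i j) params_set s"
proof -
  have diag: "M $ i $ i \<in> {0..m}" "M $ j $ j \<in> {0..m}" and off: "M $ i $ j \<in> {-m..m}"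
    using spectrum_within_diag[OF spectrum] spectrum_within_entry[OF spectrum] by blast+
  have "\<bar>t\<bar> \<le> 1" by (simp add: t_def abs_jacobi_t_le_1)
  then have t: "t \<in> {-1..1}" by auto
  have cs: "cs \<in> {0..1}" using rotation_cosine[of t] by (simp add: cs_def)
  have "\<bar>cs * t\<bar> \<le> 1 * 1"
    unfolding abs_mult by (rule mult_mono) (use t cs in auto)
  then have sn: "sn \<in> {-1..1}" unfolding sn_def abs_le_iff by auto
  let ?s1 = "s\<lparr>var_a := M $ i $ i\<rparr>"
  let ?s2 = "?s1\<lparr>var_b := M $ j $ j\<rparr>"
  let ?s3 = "?s2\<lparr>var_c := M $ i $ j\<rparr>"
  let ?s4 = "?s3\<lparr>var_t := t\<rparr>"
  let ?s5 = "?s4\<lparr>var_cs := cs\<rparr>"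
  let ?s6 = "?s5\<lparr>var_sn := sn\<rparr>"
  have "within_bounds m ?s1" "within_bounds m ?s2" "within_bounds m ?s3"
      "within_bounds m ?s4" "within_bounds m ?s5" "within_bounds m ?s6"
    by (intro within_bounds_scalars assms diag off t cs sn)+
  moreover have "jacobi_t (M $ i $ i) (M $ j $ j) (M $ i $ j) = t" "1 / sqrt (1 + t\<^sup>2) = cs"
      "cs * t = sn"
    by (simp_all only: t_def cs_def sn_def)
  ultimately show ?thesis
    using assms by (simp add: rotation_params_def params_set_def)
qed

lemma runs_within_update_pivot:
  assumes "params_set s"
  shows "runs_within (within_bounds m) (update_pivot i j) (rotating {i, j} {}) s"
proof -
  have bnd: "M $ i $ i - M $ i $ j * t \<in> {-m..m}" "M $ j $ j + M $ i $ j * t \<in> {-m..m}"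
      "0 \<in> {-m..m}"
    using spectrum_within_entry[OF spectrum', of i i] spectrum_within_entry[OF spectrum', of j j]
      spectrum_within_entry[OF spectrum', of i j] by (simp_all add: M'_pivot)
  show ?thesis
    using assms bnd pivot
    by (auto simp: update_pivot_def rotating_def params_set_def within_bounds_assign_A
        vec_eq_iff mixed_A_def mixed_X_def entry_set_entry M'_pivot)
qed

text \<open>
  Row entries are computed from old values, since \<open>k\<close> is not in \<open>D\<close>. The column entries
  are copies of them and are correct because \<open>M'\<close> is symmetric. Every value written is thus an
  entry of \<open>M'\<close> and so within bounds.
\<close>

lemma runs_within_update_A:
  assumes "k \<notin> D" and "{i, j} \<subseteq> D" and "rotating D {} s"
  shows "runs_within (within_bounds m) (update_A i j k) (rotating (insert k D) {}) s"
proof -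
  have k: "k \<noteq> i" "k \<noteq> j" "k \<notin> {i, j}" using assms by auto
  have old: "mixed_A D $ i $ k = M $ i $ k" "mixed_A D $ j $ k = M $ j $ k"
    using k assms(1) by (auto simp: mixed_A_def)
  have bnd: "cs * M $ i $ k - sn * M $ j $ k \<in> {-m..m}" "sn * M $ i $ k + cs * M $ j $ k \<in> {-m..m}"
    using spectrum_within_entry[OF spectrum', of i k] spectrum_within_entry[OF spectrum', of j k]
    by (simp_all add: M'_row k)
  have new: "M' $ k $ i = cs * M $ i $ k - sn * M $ j $ k" "M' $ k $ j = sn * M $ i $ k + cs * M $ j $ k"
    using M'_row[OF k(3)] by (simp_all add: sym'[of k])
  show ?thesis
    using assms(3) bnd pivot k
    by (auto simp: update_A_def rotating_def within_bounds_assign_A within_bounds_tmp old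
        entry_set_entry vec_eq_iff) (auto simp: mixed_A_def M'_row new)
qed

lemma runs_within_update_X:
  assumes "k \<notin> E" and "rotating UNIV E s"
  shows "runs_within (within_bounds m) (update_X i j k) (rotating UNIV (insert k E)) s"
proof -
  have old: "mixed_X E $ k = X $ k"
    using assms(1) by (simp add: mixed_X_def)
  have bnd: "cs * X $ k $ i - sn * X $ k $ j \<in> {-1..1}" "sn * X $ k $ i + cs * X $ k $ j \<in> {-1..1}"
    using orthogonal_matrix_entry_bound[OF orth', of k i]
      orthogonal_matrix_entry_bound[OF orth', of k j] by (simp_all add: X'_row)
  show ?thesis
    using assms(2) bnd pivot
    by (auto simp: update_X_def rotating_def within_bounds_assign_X within_bounds_tmp old
        entry_set_entry vec_eq_iff) (auto simp: mixed_X_def X'_row)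
qed

lemma rotating_UNIV: "rotating UNIV UNIV s \<Longrightarrow> jacobi_invariant m s"
proof -
  have "mixed_A UNIV = M'" by (auto simp: mixed_A_def vec_eq_iff M'_off)
  moreover have "mixed_X UNIV = X'" by (simp add: mixed_X_def)
  ultimately show "rotating UNIV UNIV s \<Longrightarrow> jacobi_invariant m s"
    by (simp add: rotating_def jacobi_invariant_def spectrum' orth')
qed

lemma runs_within_updates:
  assumes "rotating {i, j} {} s"
  shows "runs_within (within_bounds m)
    (concat (map (update_A i j) (filter (\<lambda>k. k \<noteq> i \<and> k \<noteq> j) indices)) @
     concat (map (update_X i j) indices)) (jacobi_invariant m) s"
proof -
  let ?ks = "filter (\<lambda>k. k \<noteq> i \<and> k \<noteq> j) (indices :: 'n list)"
  have idx: "distinct (indices :: 'n list)" "set (indices :: 'n list) = UNIV"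
    by (simp_all add: indices_def)
  have X_loop: "runs_within (within_bounds m) (concat (map (update_X i j) indices))
      (jacobi_invariant m) s" if "rotating UNIV {} s" for s
  proof -
    have "runs_within (within_bounds m) (concat (map (update_X i j) indices))
        (rotating UNIV ({} \<union> set indices)) s"
      by (rule runs_within_loop[where I = "rotating UNIV"])
        (use that idx in \<open>auto simp: rotating_def[of _ _ s] intro: runs_within_update_X\<close>)
    then show ?thesis
      by (rule runs_within_mono) (simp add: idx rotating_UNIV)
  qed
  \<comment> \<open>The invariant carries \<open>{i, j} \<subseteq> D\<close> so that no \<open>k\<close> outside \<open>D\<close> is a pivot index.\<close>
  have "runs_within (within_bounds m) (concat (map (update_A i j) ?ks))
      ((\<lambda>D s. {i, j} \<subseteq> D \<and> rotating D {} s) ({i, j} \<union> set ?ks)) s"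
  proof (rule runs_within_loop[where I = "\<lambda>D s. {i, j} \<subseteq> D \<and> rotating D {} s"])
    fix k D s
    assume "k \<notin> D" and *: "{i, j} \<subseteq> D \<and> rotating D {} s"
    then have "runs_within (within_bounds m) (update_A i j k) (rotating (insert k D) {}) s"
      by (intro runs_within_update_A) auto
    then show "runs_within (within_bounds m) (update_A i j k)
        (\<lambda>s. {i, j} \<subseteq> insert k D \<and> rotating (insert k D) {} s) s"
      by (rule runs_within_mono) (use * in auto)
  qed (use assms idx in \<open>auto simp: rotating_def\<close>)
  moreover have "{i, j} \<union> set ?ks = UNIV" using idx by auto
  ultimately have "runs_within (within_bounds m) (concat (map (update_A i j) ?ks))
      (rotating UNIV {}) s"
    by simp
  then show ?thesis
    unfolding runs_within_append by (rule runs_within_mono) (rule X_loop)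
qed

lemma runs_within_step:
  assumes "within_bounds m s" and "mat_A s = M" and "mat_X s = X"
  shows "runs_within (within_bounds m) (jacobi_iteration i j) (jacobi_invariant m) s"
proof -
  let ?updates = "concat (map (update_A i j) (filter (\<lambda>k. k \<noteq> i \<and> k \<noteq> j) indices)) @
     concat (map (update_X i j) indices)"
  have "runs_within (within_bounds m) (update_pivot i j @ ?updates) (jacobi_invariant m) s"
    if "params_set s" for s
    unfolding runs_within_append[of _ "update_pivot i j"]
    by (rule runs_within_mono[OF runs_within_update_pivot[OF that]]) (rule runs_within_updates)
  then show ?thesis
    unfolding jacobi_iteration_def runs_within_append[of _ "rotation_params i j"]
    by (rule runs_within_mono[OF runs_within_rotation_params[OF assms]])
qed

end

lemma runs_within_iteration:
  fixes s :: "'n::{finite,linorder} jacobi_state"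
  assumes "i \<noteq> j" and "jacobi_invariant m s"
  shows "runs_within (within_bounds m) (jacobi_iteration i j) (jacobi_invariant m) s"
proof -
  interpret jacobi_step m i j "mat_A s" "mat_X s"
    using assms by unfold_locales (auto simp: jacobi_invariant_def)
  show ?thesis
    using assms(2) by (intro runs_within_step) (auto simp: jacobi_invariant_def)
qed

section \<open>The whole run\<close>

lemma runs_within_program:
  fixes s :: "'n::{finite,linorder} jacobi_state"
  assumes "jacobi_invariant m s"
  shows "runs_within (within_bounds m) jacobi_program (jacobi_invariant m) s"
proof -
  let ?runs = "\<lambda>P. \<forall>s. jacobi_invariant m s \<longrightarrow>
    runs_within (within_bounds m) P (jacobi_invariant m) (s :: 'n jacobi_state)"
  have concat: "?runs (concat Ps)" if "\<forall>P \<in> set Ps. ?runs P" for Ps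
    using that by (auto intro!: runs_within_concat simp: jacobi_invariant_def[of _ s] )
      (auto simp: jacobi_invariant_def)
  have "?runs jacobi_sweep"
    unfolding jacobi_sweep_def by (auto intro!: concat[rule_format] runs_within_iteration)
  then have "?runs jacobi_program"
    unfolding jacobi_program_def by (intro concat) auto
  with assms show ?thesis by blast
qed

lemma jacobi_invariant_init:
  fixes A :: "real^'n^'n"
  assumes "spectrum_within m A"
  shows "jacobi_invariant m (jacobi_init A)"
proof -
  have "0 \<le> m" using spectrum_within_diag[OF assms, of undefined] by auto
  moreover have "mat 1 $ i $ j \<in> {-1..1::real}" for i j :: 'n
    by (simp add: mat_def)
  ultimately show ?thesis
    using assms spectrum_within_entry[OF assms]
    by (simp add: jacobi_invariant_def within_bounds_def jacobi_init_def orthogonal_matrix_id)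
qed

theorem theorem1:
  fixes A :: "real^'n::{finite,linorder}^'n::{finite,linorder}" and m :: real
  assumes "pos_semidef A"
    and "m = sqrt (norm_one A * norm_inf A)"
  shows "spectral_norm A \<le> m \<and>
    (\<forall>s \<in> jacobi_run A.
       (\<forall>i j. mat_A s $ i $ j \<in> {-m..m}) \<and>
       var_t s \<in> {-1..1} \<and>
       var_cs s \<in> {0..1} \<and>
       var_sn s \<in> {-1..1} \<and>
       (\<forall>i j. mat_X s $ i $ j \<in> {-1..1}) \<and>
       var_a s \<in> {0..m} \<and>
       var_b s \<in> {0..m} \<and>
       var_c s \<in> {-m..m}) \<and>
    (\<forall>i. jacobi_lambda A i \<in> {0..m})"
proof -
  have "spectrum_within m A"
    unfolding assms(2) by (rule spectrum_within_pos_semidef[OF assms(1)])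
  then have run: "runs_within (within_bounds m) jacobi_program (jacobi_invariant m) (jacobi_init A)"
    by (intro runs_within_program jacobi_invariant_init)
  have "\<forall>s \<in> jacobi_run A. within_bounds m s"
    using runs_within_execute(1)[OF run] by (auto simp: jacobi_run_def)
  moreover have "\<forall>i. jacobi_lambda A i \<in> {0..m}"
    using runs_within_execute(2)[OF run] spectrum_within_diag
    unfolding jacobi_lambda_def jacobi_invariant_def by blast
  moreover have "spectral_norm A \<le> m"
    unfolding assms(2) by (rule spectral_norm_le)
  ultimately show ?thesis
    unfolding within_bounds_def by blast
qed

end
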